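(* Let $(A,\triangleright,\triangleleft,\alpha)$ be a finite-dimensional Hom-L-dendriform algebra with $\alpha$ invertible, let $\{v_1,\dots,v_n\}$ be a basis of $A$ and $\{v_1^*,\dots,v_n^*\}$ its dual basis. Let $(A,\cdot,\alpha)$, $x\cdot y=x\triangleright y-y\triangleleft x$, be the associated vertical Hom-pre-Lie algebra. Then $$r=\sum_{i}(v_i\otimes v_i^*+v_i^*\otimes v_i)$$ is a Hom-$\mathfrak s$-matrix in the semidirect product Hom-pre-Lie algebra $A\ltimes_{(L_\triangleright^\star+L_\triangleleft^\star,\,L_\triangleleft^\star)}A^*$ of $(A,\cdot,\alpha)$.
   Context: Vector spaces are over a field; for a linear map $f$ between vector spaces $f^*$ is the usual transpose. Hom-pre-Lie algebra: $(A,\cdot,\alpha)$ with $\cdot$ bilinear, $\alpha:A\to A$ linear, $\alpha(x\cdot y)=\alpha(x)\cdot\alpha(y)$ and $(x\cdot y)\cdot\alpha(z)-\alpha(x)\cdot(y\cdot z)=(y\cdot x)\cdot\alpha(z)-\alpha(y)\cdot(x\cdot z)$. $[x,y]=x\cdot y-y\cdot x$. Hom-L-dendriform algebra $(A,\triangleright,\triangleleft,\alpha)$: a vector space with bilinear products $\triangleright,\triangleleft$ and a linear map $\alpha:A\to A$ which is multiplicative for both products, such that for all $x,y,z\in A$ $(x\triangleright y)\triangleright\alpha(z)+(x\triangleleft y)\triangleright\alpha(z)+\alpha(y)\triangleright(x\triangleright z)-(y\triangleleft x)\triangleright\alpha(z)-(y\triangleright x)\triangleright\alpha(z)-\alpha(x)\triangleright(y\triangleright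 z)=0$ and $(x\triangleright y)\triangleleft\alpha(z)+\alpha(y)\triangleleft(x\triangleright z)+\alpha(y)\triangleleft(x\triangleleft z)-(y\triangleleft x)\triangleleft\alpha(z)-\alpha(x)\triangleright(y\triangleleft z)=0$. The product $x\cdot y=x\triangleright y-y\triangleleft x$ makes $(A,\cdot,\alpha)$ a Hom-pre-Lie algebra, the associated vertical Hom-pre-Lie algebra. Let $L_\triangleright(x)y=x\triangleright y$, $L_\triangleleft(x)y=x\triangleleft y$; for $M\in\{L_\triangleright,L_\triangleleft\}$ let $\langle M^*(x)\xi,y\rangle=-\langle\xi,M(x)y\rangle$ and $M^\star(x)\xi=M^*(\alpha(x))((\alpha^{-2})^*\xi)$ for $x,y\in A$, $\xi\in A^*$. The semidirect product $A\ltimes_{(L_\triangleright^\star+L_\triangleleft^\star,L_\triangleleft^\star)}A^*$ is $A\oplus A^*$ with product $(x+\xi)\cdot(y+\eta)=x\cdot y+(L_\triangleright^\star+L_\triangleleft^\star)(x)\eta+L_\triangleleft^\star(y)\xi$ and twisting map $\alpha\oplus(\alpha^{-1})^*$. Hom-$\mathfrak s$-matrix in a Hom-pre-Lie algebra $(B,\cdot,\gamma)$ with $\gamma$ invertible: for $r=\sum_i x_i\otimes y_i\in B\otimes B$ let $r^\sharp:B^*\to B$ be $\langle r^\sharp(\xi),\eta\rangle=\langle r,\xi\otimes\eta\rangle$, and $$[[r,r]]=\sum_{i,j}\Big(\gamma(x_i)\otimes[y_i,x_j]\otimes\gamma(y_j)-x_i\cdot x_j\otimes\gamma(y_j)\otimes\gamma(y_i)+\gamma(x_i)\otimes\gamma(x_j)\otimes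 y_i\cdot y_j\Big).$$ $r$ is a Hom-$\mathfrak s$-matrix if it is symmetric, $r^\sharp\circ(\gamma^{-1})^*=\gamma\circ r^\sharp$ and $[[r,r]]=0$. *)

theory Defs
  imports
    Complex_Main
    "HOL-Library.Poly_Mapping"
    "HOL-Library.Function_Algebras"
    "HOL-Library.Product_Plus"
begin

section \<open>Linear maps and dual spaces on a subspace of an ambient type\<close>

definition linear_map_on ::
  "('k::field \<Rightarrow> 'b::ab_group_add \<Rightarrow> 'b) \<Rightarrow> ('k \<Rightarrow> 'c::ab_group_add \<Rightarrow> 'c) \<Rightarrow> 'b set \<Rightarrow> ('b \<Rightarrow> 'c) \<Rightarrow> bool"
  where "linear_map_on s1 s2 B f \<longleftrightarrow>
    (\<forall>x\<in>B. \<forall>y\<in>B. f (x + y) = f x + f y) \<and> (\<forall>c. \<forall>x\<in>B. f (s1 c x) = s2 c (f x))"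

text \<open>Functionals on \<open>B\<close> are extended by \<open>0\<close> outside \<open>B\<close>, so that every functional on \<open>B\<close>
  is represented by exactly one function. For \<open>B = UNIV\<close> this is the usual dual space.\<close>

definition dual_space :: "('k::field \<Rightarrow> 'b::ab_group_add \<Rightarrow> 'b) \<Rightarrow> 'b set \<Rightarrow> ('b \<Rightarrow> 'k) set"
  where "dual_space s B = {\<xi>. linear_map_on s (*) B \<xi> \<and> (\<forall>x. x \<notin> B \<longrightarrow> \<xi> x = 0)}"

definition dual_map :: "'b set \<Rightarrow> ('b \<Rightarrow> 'b) \<Rightarrow> ('b \<Rightarrow> 'k::zero) \<Rightarrow> 'b \<Rightarrow> 'k"
  where "dual_map B f \<xi> = (\<lambda>x. if x \<in> B then \<xi> (f x) else 0)"

text \<open>\<open>v\<^sup>*\<close> for \<open>v\<close> in the basis \<open>V\<close>: the functional reading off the coefficient of \<open>v\<close>.\<close>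

definition dual_vec :: "('k::field \<Rightarrow> 'a::ab_group_add \<Rightarrow> 'a) \<Rightarrow> 'a set \<Rightarrow> 'a \<Rightarrow> 'a \<Rightarrow> 'k"
  where "dual_vec s V v = (\<lambda>x. module.representation s V x v)"


section \<open>Tensor products of a subspace with itself\<close>

text \<open>The spaces \<open>B \<otimes> B\<close> and \<open>B \<otimes> B \<otimes> B\<close> are free vector spaces (finitely supported functions)
  on \<open>B \<times> B\<close> and \<open>B \<times> B \<times> B\<close> modulo the multilinearity relations. We work with elements of the
  free space; two of them are equal as tensors iff their difference lies in \<open>tensor2_null\<close>
  respectively \<open>tensor3_null\<close>.\<close>

definition free_scale :: "'k::field \<Rightarrow> ('t \<Rightarrow>\<^sub>0 'k) \<Rightarrow> ('t \<Rightarrow>\<^sub>0 'k)"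
  where "free_scale c t = Poly_Mapping.map ((*) c) t"

lemma lookup_free_scale [simp]: "Poly_Mapping.lookup (free_scale c t) x = c * Poly_Mapping.lookup t x"
  by (simp add: free_scale_def Poly_Mapping.map.rep_eq when_def in_keys_iff)

interpretation free: vector_space free_scale
  by unfold_locales (auto intro!: poly_mapping_eqI simp: lookup_add algebra_simps)

definition tensor2 :: "'b \<Rightarrow> 'b \<Rightarrow> ('b \<times> 'b \<Rightarrow>\<^sub>0 'k::field)"
  where "tensor2 x y = Poly_Mapping.single (x, y) 1"

definition tensor3 :: "'b \<Rightarrow> 'b \<Rightarrow> 'b \<Rightarrow> ('b \<times> 'b \<times> 'b \<Rightarrow>\<^sub>0 'k::field)"
  where "tensor3 x y z = Poly_Mapping.single (x, y, z) 1"

definition tensor2_null ::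
  "('k::field \<Rightarrow> 'b::ab_group_add \<Rightarrow> 'b) \<Rightarrow> 'b set \<Rightarrow> ('b \<times> 'b \<Rightarrow>\<^sub>0 'k) set"
  where "tensor2_null s B = free.span (
      {tensor2 (x + x') y - tensor2 x y - tensor2 x' y | x x' y. x \<in> B \<and> x' \<in> B \<and> y \<in> B}
    \<union> {tensor2 x (y + y') - tensor2 x y - tensor2 x y' | x y y'. x \<in> B \<and> y \<in> B \<and> y' \<in> B}
    \<union> {tensor2 (s c x) y - free_scale c (tensor2 x y) | c x y. x \<in> B \<and> y \<in> B}
    \<union> {tensor2 x (s c y) - free_scale c (tensor2 x y) | c x y. x \<in> B \<and> y \<in> B})"

definition tensor3_null ::
  "('k::field \<Rightarrow> 'b::ab_group_add \<Rightarrow> 'b) \<Rightarrow> 'b set \<Rightarrow> ('b \<times> 'b \<times> 'b \<Rightarrow>\<^sub>0 'k) set"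
  where "tensor3_null s B = free.span (
      {tensor3 (x + x') y z - tensor3 x y z - tensor3 x' y z | x x' y z.
          x \<in> B \<and> x' \<in> B \<and> y \<in> B \<and> z \<in> B}
    \<union> {tensor3 x (y + y') z - tensor3 x y z - tensor3 x y' z | x y y' z.
          x \<in> B \<and> y \<in> B \<and> y' \<in> B \<and> z \<in> B}
    \<union> {tensor3 x y (z + z') - tensor3 x y z - tensor3 x y z' | x y z z'.
          x \<in> B \<and> y \<in> B \<and> z \<in> B \<and> z' \<in> B}
    \<union> {tensor3 (s c x) y z - free_scale c (tensor3 x y z) | c x y z. x \<in> B \<and> y \<in> B \<and> z \<in> B}
    \<union> {tensor3 x (s c y) z - free_scale c (tensor3 x y z) | c x y z. x \<in> B \<and> y \<in> B \<and> z \<in> B}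
    \<union> {tensor3 x y (s c z) - free_scale c (tensor3 x y z) | c x y z. x \<in> B \<and> y \<in> B \<and> z \<in> B})"

definition tensor2_flip :: "('b \<times> 'b \<Rightarrow>\<^sub>0 'k::field) \<Rightarrow> ('b \<times> 'b \<Rightarrow>\<^sub>0 'k)"
  where "tensor2_flip r = (\<Sum>(x, y)\<in>Poly_Mapping.keys r. free_scale (Poly_Mapping.lookup r (x, y)) (tensor2 y x))"

text \<open>The pairing \<open>\<langle>r, \<xi> \<otimes> \<eta>\<rangle>\<close>.\<close>

definition tensor2_pairing ::
  "('b \<times> 'b \<Rightarrow>\<^sub>0 'k::field) \<Rightarrow> ('b \<Rightarrow> 'k) \<Rightarrow> ('b \<Rightarrow> 'k) \<Rightarrow> 'k"
  where "tensor2_pairing r \<xi> \<eta> = (\<Sum>(x, y)\<in>Poly_Mapping.keys r. Poly_Mapping.lookup r (x, y) * (\<xi> x * \<eta> y))"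

definition sharp ::
  "('k::field \<Rightarrow> 'b::ab_group_add \<Rightarrow> 'b) \<Rightarrow> 'b set \<Rightarrow> ('b \<times> 'b \<Rightarrow>\<^sub>0 'k) \<Rightarrow> ('b \<Rightarrow> 'k) \<Rightarrow> 'b"
  where "sharp s B r \<xi> = (THE b. b \<in> B \<and> (\<forall>\<eta>\<in>dual_space s B. \<eta> b = tensor2_pairing r \<xi> \<eta>))"


section \<open>Hom-pre-Lie algebras and Hom-s-matrices\<close>

text \<open>The algebra lives on a subspace \<open>B\<close> of the ambient type.\<close>

locale hom_pre_Lie_algebra = vector_space scale
  for scale :: "'k::field \<Rightarrow> 'b::ab_group_add \<Rightarrow> 'b"
    and B :: "'b set"
    and mult :: "'b \<Rightarrow> 'b \<Rightarrow> 'b" (infixl \<open>\<cdot>\<close> 70)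
    and \<gamma> :: "'b \<Rightarrow> 'b" +
  assumes subspace: "subspace B"
    and mult_closed: "\<And>x y. x \<in> B \<Longrightarrow> y \<in> B \<Longrightarrow> x \<cdot> y \<in> B"
    and mult_linear_left: "\<And>y. y \<in> B \<Longrightarrow> linear_map_on scale scale B (\<lambda>x. x \<cdot> y)"
    and mult_linear_right: "\<And>x. x \<in> B \<Longrightarrow> linear_map_on scale scale B (\<lambda>y. x \<cdot> y)"
    and twist_closed: "\<And>x. x \<in> B \<Longrightarrow> \<gamma> x \<in> B"
    and twist_linear: "linear_map_on scale scale B \<gamma>"
    and twist_mult: "\<And>x y. x \<in> B \<Longrightarrow> y \<in> B \<Longrightarrow> \<gamma> (x \<cdot> y) = \<gamma> x \<cdot> \<gamma> y"
    and hom_pre_Lie: "\<And>x y z. x \<in> B \<Longrightarrow> y \<in> B \<Longrightarrow> z \<in> B \<Longrightarrow>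
      (x \<cdot> y) \<cdot> \<gamma> z - \<gamma> x \<cdot> (y \<cdot> z) = (y \<cdot> x) \<cdot> \<gamma> z - \<gamma> y \<cdot> (x \<cdot> z)"

definition commutator :: "('b \<Rightarrow> 'b \<Rightarrow> 'b::minus) \<Rightarrow> 'b \<Rightarrow> 'b \<Rightarrow> 'b"
  where "commutator mult x y = mult x y - mult y x"

text \<open>The element \<open>[[r, r]]\<close>, for \<open>r = \<Sum>\<^sub>i c\<^sub>i x\<^sub>i \<otimes> y\<^sub>i\<close> with the scalars \<open>c\<^sub>i\<close>
  pulled out of the tensors by multilinearity. For \<open>mult\<close> bilinear and \<open>\<gamma>\<close> linear on \<open>B\<close>, changing \<open>r\<close>
  by an element of \<open>tensor2_null\<close> changes \<open>[[r, r]]\<close> by an element of \<open>tensor3_null\<close>.\<close>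

definition tensor_bracket ::
  "('b::ab_group_add \<Rightarrow> 'b \<Rightarrow> 'b) \<Rightarrow> ('b \<Rightarrow> 'b) \<Rightarrow> ('b \<times> 'b \<Rightarrow>\<^sub>0 'k::field) \<Rightarrow> ('b \<times> 'b \<times> 'b \<Rightarrow>\<^sub>0 'k)"
  where "tensor_bracket mult \<gamma> r =
    (\<Sum>(x, y)\<in>Poly_Mapping.keys r. \<Sum>(x', y')\<in>Poly_Mapping.keys r.
      free_scale (Poly_Mapping.lookup r (x, y) * Poly_Mapping.lookup r (x', y'))
      (tensor3 (\<gamma> x) (commutator mult y x') (\<gamma> y')
       - tensor3 (mult x x') (\<gamma> y') (\<gamma> y)
       + tensor3 (\<gamma> x) (\<gamma> x') (mult y y')))"

definition hom_s_matrix ::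
  "('k::field \<Rightarrow> 'b::ab_group_add \<Rightarrow> 'b) \<Rightarrow> 'b set \<Rightarrow> ('b \<Rightarrow> 'b \<Rightarrow> 'b) \<Rightarrow> ('b \<Rightarrow> 'b)
    \<Rightarrow> ('b \<times> 'b \<Rightarrow>\<^sub>0 'k) \<Rightarrow> bool"
  where "hom_s_matrix s B mult \<gamma> r \<longleftrightarrow>
    hom_pre_Lie_algebra s B mult \<gamma> \<and> bij_betw \<gamma> B B \<and>
    Poly_Mapping.keys r \<subseteq> B \<times> B \<and>
    tensor2_flip r - r \<in> tensor2_null s B \<and>
    (\<forall>\<xi>\<in>dual_space s B. sharp s B r (dual_map B (inv_into B \<gamma>) \<xi>) = \<gamma> (sharp s B r \<xi>)) \<and>
    tensor_bracket mult \<gamma> r \<in> tensor3_null s B"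


section \<open>Hom-L-dendriform algebras\<close>

locale hom_L_dendriform_algebra = vector_space scale
  for scale :: "'k::field \<Rightarrow> 'a::ab_group_add \<Rightarrow> 'a"
    and rtri :: "'a \<Rightarrow> 'a \<Rightarrow> 'a" (infixl \<open>\<triangleright>\<close> 70)
    and ltri :: "'a \<Rightarrow> 'a \<Rightarrow> 'a" (infixl \<open>\<triangleleft>\<close> 70)
    and \<alpha> :: "'a \<Rightarrow> 'a" +
  assumes rtri_linear_left: "\<And>y. Vector_Spaces.linear scale scale (\<lambda>x. x \<triangleright> y)"
    and rtri_linear_right: "\<And>x. Vector_Spaces.linear scale scale (\<lambda>y. x \<triangleright> y)"
    and ltri_linear_left: "\<And>y. Vector_Spaces.linear scale scale (\<lambda>x. x \<triangleleft> y)"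
    and ltri_linear_right: "\<And>x. Vector_Spaces.linear scale scale (\<lambda>y. x \<triangleleft> y)"
    and twist_linear: "Vector_Spaces.linear scale scale \<alpha>"
    and twist_rtri: "\<And>x y. \<alpha> (x \<triangleright> y) = \<alpha> x \<triangleright> \<alpha> y"
    and twist_ltri: "\<And>x y. \<alpha> (x \<triangleleft> y) = \<alpha> x \<triangleleft> \<alpha> y"
    and dendriform1: "\<And>x y z.
      (x \<triangleright> y) \<triangleright> \<alpha> z + (x \<triangleleft> y) \<triangleright> \<alpha> z + \<alpha> y \<triangleright> (x \<triangleright> z)
      - (y \<triangleleft> x) \<triangleright> \<alpha> z - (y \<triangleright> x) \<triangleright> \<alpha> z - \<alpha> x \<triangleright> (y \<triangleright> z) = 0"
    and dendriform2: "\<And>x y z.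
      (x \<triangleright> y) \<triangleleft> \<alpha> z + \<alpha> y \<triangleleft> (x \<triangleright> z) + \<alpha> y \<triangleleft> (x \<triangleleft> z)
      - (y \<triangleleft> x) \<triangleleft> \<alpha> z - \<alpha> x \<triangleright> (y \<triangleleft> z) = 0"

definition vertical_mult :: "('a \<Rightarrow> 'a \<Rightarrow> 'a) \<Rightarrow> ('a \<Rightarrow> 'a \<Rightarrow> 'a) \<Rightarrow> 'a \<Rightarrow> 'a \<Rightarrow> 'a::minus"
  where "vertical_mult rtri ltri x y = rtri x y - ltri y x"

text \<open>The operators \<open>M\<^sup>*(x)\<close> and \<open>M\<^sup>\<star>(x)\<close>. A multiplication \<open>M\<close>, being curried,
  is its own left multiplication operator \<open>L\<^sub>M\<close>.\<close>

definition dual_action :: "('a \<Rightarrow> 'a \<Rightarrow> 'a) \<Rightarrow> 'a \<Rightarrow> ('a \<Rightarrow> 'k::field) \<Rightarrow> 'a \<Rightarrow> 'k"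
  where "dual_action M x \<xi> = (\<lambda>y. - \<xi> (M x y))"

definition star_action ::
  "('a \<Rightarrow> 'a) \<Rightarrow> ('a \<Rightarrow> 'a \<Rightarrow> 'a) \<Rightarrow> 'a \<Rightarrow> ('a \<Rightarrow> 'k::field) \<Rightarrow> 'a \<Rightarrow> 'k"
  where "star_action \<alpha> M x \<xi> = dual_action M (\<alpha> x) (dual_map UNIV (inv \<alpha> ^^ 2) \<xi>)"


section \<open>The semidirect product on the direct sum of a space and its dual\<close>

definition double_scale ::
  "('k::field \<Rightarrow> 'a \<Rightarrow> 'a) \<Rightarrow> 'k \<Rightarrow> 'a \<times> ('a \<Rightarrow> 'k) \<Rightarrow> 'a \<times> ('a \<Rightarrow> 'k)"
  where "double_scale s c = (\<lambda>(x, \<xi>). (s c x, \<lambda>y. c * \<xi> y))"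

definition double_space :: "('k::field \<Rightarrow> 'a::ab_group_add \<Rightarrow> 'a) \<Rightarrow> ('a \<times> ('a \<Rightarrow> 'k)) set"
  where "double_space s = UNIV \<times> dual_space s UNIV"

text \<open>\<open>(x + \<xi>) \<cdot> (y + \<eta>) = x \<cdot> y + \<rho>(x)\<eta> + \<mu>(y)\<xi>\<close>, with \<open>x + \<xi>\<close> written as the pair \<open>(x, \<xi>)\<close>.\<close>

definition semidirect_mult ::
  "('a \<Rightarrow> 'a \<Rightarrow> 'a) \<Rightarrow> ('a \<Rightarrow> 'd \<Rightarrow> 'd) \<Rightarrow> ('a \<Rightarrow> 'd \<Rightarrow> 'd) \<Rightarrow> 'a \<times> 'd \<Rightarrow> 'a \<times> 'd \<Rightarrow> 'a \<times> 'd::plus"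
  where "semidirect_mult mult \<rho> \<mu> = (\<lambda>(x, \<xi>) (y, \<eta>). (mult x y, \<rho> x \<eta> + \<mu> y \<xi>))"

definition double_twist :: "('a \<Rightarrow> 'a) \<Rightarrow> 'a \<times> ('a \<Rightarrow> 'k::zero) \<Rightarrow> 'a \<times> ('a \<Rightarrow> 'k)"
  where "double_twist \<alpha> = (\<lambda>(x, \<xi>). (\<alpha> x, dual_map UNIV (inv \<alpha>) \<xi>))"

text \<open>Multiplication of the semidirect product with representation
  \<open>(L\<^sub>\<triangleright>\<^sup>\<star> + L\<^sub>\<triangleleft>\<^sup>\<star>, L\<^sub>\<triangleleft>\<^sup>\<star>)\<close>.\<close>

definition double_mult ::
  "('a::ab_group_add \<Rightarrow> 'a \<Rightarrow> 'a) \<Rightarrow> ('a \<Rightarrow> 'a \<Rightarrow> 'a) \<Rightarrow> ('a \<Rightarrow> 'a)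
    \<Rightarrow> 'a \<times> ('a \<Rightarrow> 'k::field) \<Rightarrow> 'a \<times> ('a \<Rightarrow> 'k) \<Rightarrow> 'a \<times> ('a \<Rightarrow> 'k)"
  where "double_mult rtri ltri \<alpha> = semidirect_mult (vertical_mult rtri ltri)
    (\<lambda>x \<xi>. star_action \<alpha> rtri x \<xi> + star_action \<alpha> ltri x \<xi>) (star_action \<alpha> ltri)"

end

theory Submission
  imports Defs
begin

text \<open>Let \<open>\<omega>(x + \<xi>, y + \<eta>) = \<xi>(y) + \<eta>(x)\<close> be the canonical symmetric form on \<open>A \<oplus> A\<^sup>*\<close>.
  The twist \<open>\<gamma>\<close> is orthogonal for \<open>\<omega>\<close>, and \<open>r\<close> is the canonical element of \<open>\<omega>\<close>: contracting one of its
  legs with \<open>\<omega>(a, -)\<close> leaves \<open>a\<close> in the other. Hence \<open>r\<^sup>\<sharp>\<close> inverts \<open>a \<mapsto> \<omega>(a, -)\<close>, which gives its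
  compatibility with \<open>\<gamma>\<close>, and evaluating \<open>[[r, r]]\<close> on
  \<open>\<omega>(\<gamma> a, -) \<otimes> \<omega>(\<gamma> b, -) \<otimes> \<omega>(\<gamma> c, -)\<close> yields
  \<open>\<omega>(\<gamma> b, [a, c]) - \<omega>(\<gamma> a, c \<cdot> b) + \<omega>(\<gamma> c, a \<cdot> b)\<close>, which vanishes identically by the definition of the
  semidirect product. A tensor on which all these functionals vanish is zero.\<close>

section \<open>Finite sums and linear maps on a subspace\<close>

lemma sum_apply: "(\<Sum>i\<in>I. f i) x = (\<Sum>i\<in>I. f i x)"
  by (induction I rule: infinite_finite_induct) simp_all

lemma linear_map_on_sum:
  assumes "vector_space s1" "module.subspace s1 B" "linear_map_on s1 s2 B f"
    and "finite I" "\<And>i. i \<in> I \<Longrightarrow> x i \<in> B"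
  shows "f (\<Sum>i\<in>I. s1 (c i) (x i)) = (\<Sum>i\<in>I. s2 (c i) (f (x i)))"
proof -
  interpret vector_space s1 by fact
  have zero: "f 0 = 0"
  proof -
    have "f (0 + 0) = f 0 + f 0"
      using assms(2,3) subspace_0 unfolding linear_map_on_def by blast
    then show ?thesis by simp
  qed
  show ?thesis
    using assms(4,5)
  proof (induction I rule: finite_induct)
    case empty
    then show ?case by (simp add: zero)
  next
    case (insert i I)
    have "s1 (c i) (x i) \<in> B" "(\<Sum>i\<in>I. s1 (c i) (x i)) \<in> B"
      using insert assms(2) by (auto intro!: subspace_scale subspace_sum)
    with insert assms(3) show ?case
      by (simp add: linear_map_on_def)
  qed
qed

section \<open>Vanishing of tensors\<close>

text \<open>The linear extension of \<open>f\<close> from generators to the free space; for a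
  trilinear \<open>f\<close> on \<open>B\<close> it is the pairing of a tensor with
  \<open>f\<close>.\<close>

definition free_eval :: "('t \<Rightarrow> 'k::field) \<Rightarrow> ('t \<Rightarrow>\<^sub>0 'k) \<Rightarrow> 'k"
  where "free_eval f t = (\<Sum>k\<in>Poly_Mapping.keys t. Poly_Mapping.lookup t k * f k)"

text \<open>Keys may cancel in a sum, so tensors are compared over a common finite set containing
  all their keys.\<close>

lemma free_eval_superset:
  assumes "finite K" "Poly_Mapping.keys t \<subseteq> K"
  shows "free_eval f t = (\<Sum>k\<in>K. Poly_Mapping.lookup t k * f k)"
  unfolding free_eval_def using assms
  by (intro sum.mono_neutral_left) (auto simp: in_keys_iff)

lemma free_eval_add: "free_eval f (t + u) = free_eval f t + free_eval f u"
proof -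
  let ?K = "Poly_Mapping.keys t \<union> Poly_Mapping.keys u"
  have "Poly_Mapping.keys (t + u) \<subseteq> ?K"
    by (rule Poly_Mapping.keys_add)
  then show ?thesis
    by (simp add: free_eval_superset[of ?K] lookup_add algebra_simps sum.distrib)
qed

lemma free_eval_scale: "free_eval f (free_scale c t) = c * free_eval f t"
proof -
  have "Poly_Mapping.keys (free_scale c t) \<subseteq> Poly_Mapping.keys t"
    by (auto simp: in_keys_iff)
  then show ?thesis
    by (simp add: free_eval_superset[of "Poly_Mapping.keys t"] sum_distrib_left mult.assoc)
qed

lemma free_eval_zero: "free_eval f 0 = 0"
  by (simp add: free_eval_def)

lemma free_eval_diff: "free_eval f (t - u) = free_eval f t - free_eval f u"
  using free_eval_add[of f "t - u" u] by (simp add: algebra_simps)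

lemma free_eval_sum: "free_eval f (\<Sum>i\<in>I. t i) = (\<Sum>i\<in>I. free_eval f (t i))"
  by (induction I rule: infinite_finite_induct) (simp_all add: free_eval_zero free_eval_add)

lemma free_eval_tensor3: "free_eval f (tensor3 x y z) = f (x, y, z)"
  by (simp add: free_eval_def tensor3_def)

lemma free_expansion:
  "t = (\<Sum>k\<in>Poly_Mapping.keys t. free_scale (Poly_Mapping.lookup t k) (Poly_Mapping.single k 1))"
  by (rule poly_mapping_eqI)
    (auto simp: lookup_sum lookup_single when_def in_keys_iff if_distrib cong: if_cong)

lemma tensor3_null_relations:
  assumes "x \<in> B" "y \<in> B" "z \<in> B"
  shows "x' \<in> B \<Longrightarrow> tensor3 (x + x') y z - tensor3 x y z - tensor3 x' y z \<in> tensor3_null s B"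
    and "y' \<in> B \<Longrightarrow> tensor3 x (y + y') z - tensor3 x y z - tensor3 x y' z \<in> tensor3_null s B"
    and "z' \<in> B \<Longrightarrow> tensor3 x y (z + z') - tensor3 x y z - tensor3 x y z' \<in> tensor3_null s B"
    and "tensor3 (s c x) y z - free_scale c (tensor3 x y z) \<in> tensor3_null s B"
    and "tensor3 x (s c y) z - free_scale c (tensor3 x y z) \<in> tensor3_null s B"
    and "tensor3 x y (s c z) - free_scale c (tensor3 x y z) \<in> tensor3_null s B"
proof -
  show "tensor3 (x + x') y z - tensor3 x y z - tensor3 x' y z \<in> tensor3_null s B" if "x' \<in> B"
    unfolding tensor3_null_def
    by (rule free.span_base, rule UnI1, rule UnI1, rule UnI1, rule UnI1, rule UnI1) (use assms that in \<open>blast\<close>)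
  show "tensor3 x (y + y') z - tensor3 x y z - tensor3 x y' z \<in> tensor3_null s B" if "y' \<in> B"
    unfolding tensor3_null_def
    by (rule free.span_base, rule UnI1, rule UnI1, rule UnI1, rule UnI1, rule UnI2) (use assms that in \<open>blast\<close>)
  show "tensor3 x y (z + z') - tensor3 x y z - tensor3 x y z' \<in> tensor3_null s B" if "z' \<in> B"
    unfolding tensor3_null_def
    by (rule free.span_base, rule UnI1, rule UnI1, rule UnI1, rule UnI2) (use assms that in \<open>blast\<close>)
  show "tensor3 (s c x) y z - free_scale c (tensor3 x y z) \<in> tensor3_null s B"
    unfolding tensor3_null_def
    by (rule free.span_base, rule UnI1, rule UnI1, rule UnI2) (use assms in \<open>blast\<close>)
  show "tensor3 x (s c y) z - free_scale c (tensor3 x y z) \<in> tensor3_null s B"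
    unfolding tensor3_null_def
    by (rule free.span_base, rule UnI1, rule UnI2) (use assms in \<open>blast\<close>)
  show "tensor3 x y (s c z) - free_scale c (tensor3 x y z) \<in> tensor3_null s B"
    unfolding tensor3_null_def
    by (rule free.span_base, rule UnI2) (use assms in \<open>blast\<close>)
qed

text \<open>With two slots fixed, \<open>tensor3\<close> is linear modulo the null space in the
  remaining one. The three claims are thus instances of a single statement \<open>gen\<close> about
  such a map \<open>t\<close>.\<close>

lemma tensor3_multilinear:
  assumes "vector_space s" "module.subspace s B"
    and W: "finite W" "W \<subseteq> B"
    and B: "x \<in> B" "y \<in> B"
  shows "tensor3 (\<Sum>w\<in>W. s (c w) w) x y - (\<Sum>w\<in>W. free_scale (c w) (tensor3 w x y)) \<in> tensor3_null s B"
    and "tensor3 x (\<Sum>w\<in>W. s (c w) w) y - (\<Sum>w\<in>W. free_scale (c w) (tensor3 x w y)) \<in> tensor3_null s B"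
    and "tensor3 x y (\<Sum>w\<in>W. s (c w) w) - (\<Sum>w\<in>W. free_scale (c w) (tensor3 x y w)) \<in> tensor3_null s B"
proof -
  interpret vector_space s by fact
  have zero: "t 0 \<in> tensor3_null s B"
    if add: "\<And>a b. a \<in> B \<Longrightarrow> b \<in> B \<Longrightarrow> t (a + b) - t a - t b \<in> tensor3_null s B"
    for t :: "'b \<Rightarrow> 'b \<times> 'b \<times> 'b \<Rightarrow>\<^sub>0 'a"
  proof -
    \<comment> \<open>The additivity relation at \<open>0 + 0\<close> collapses to
      \<open>- t 0\<close>.\<close>
    have "- (t (0 + 0) - t 0 - t 0) \<in> tensor3_null s B"
      using add[of 0 0] subspace_0[OF assms(2)]
      unfolding tensor3_null_def by (intro free.span_neg) auto
    then show ?thesis by simp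
  qed
  have gen: "t (\<Sum>w\<in>W. s (c w) w) - (\<Sum>w\<in>W. free_scale (c w) (t w)) \<in> tensor3_null s B"
    if add: "\<And>a b. a \<in> B \<Longrightarrow> b \<in> B \<Longrightarrow> t (a + b) - t a - t b \<in> tensor3_null s B"
      and scl: "\<And>c a. a \<in> B \<Longrightarrow> t (s c a) - free_scale c (t a) \<in> tensor3_null s B"
    for t :: "'b \<Rightarrow> 'b \<times> 'b \<times> 'b \<Rightarrow>\<^sub>0 'a"
    using W
  proof (induction W rule: finite_induct)
    case empty
    then show ?case using zero[OF add] by simp
  next
    case (insert w W)
    have mem: "s (c w) w \<in> B" "(\<Sum>w\<in>W. s (c w) w) \<in> B" "w \<in> B"
      using insert assms(2) by (auto intro!: subspace_scale subspace_sum)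
    \<comment> \<open>The additivity relation, the scaling relation and the induction hypothesis
      telescope to the claim for \<open>insert w W\<close>.\<close>
    have "(t (s (c w) w + (\<Sum>w\<in>W. s (c w) w)) - t (s (c w) w) - t (\<Sum>w\<in>W. s (c w) w))
        + (t (s (c w) w) - free_scale (c w) (t w))
        + (t (\<Sum>w\<in>W. s (c w) w) - (\<Sum>w\<in>W. free_scale (c w) (t w))) \<in> tensor3_null s B"
      using add[OF mem(1,2)] scl[OF mem(3), of "c w"] insert
      unfolding tensor3_null_def by (intro free.span_add) auto
    then show ?case using insert by (simp add: algebra_simps)
  qed
  show "tensor3 (\<Sum>w\<in>W. s (c w) w) x y - (\<Sum>w\<in>W. free_scale (c w) (tensor3 w x y)) \<in> tensor3_null s B"
    by (rule gen[where t = "\<lambda>w. tensor3 w x y"]) (use B in \<open>simp_all add: tensor3_null_relations\<close>)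
  show "tensor3 x (\<Sum>w\<in>W. s (c w) w) y - (\<Sum>w\<in>W. free_scale (c w) (tensor3 x w y)) \<in> tensor3_null s B"
    by (rule gen[where t = "\<lambda>w. tensor3 x w y"]) (use B in \<open>simp_all add: tensor3_null_relations\<close>)
  show "tensor3 x y (\<Sum>w\<in>W. s (c w) w) - (\<Sum>w\<in>W. free_scale (c w) (tensor3 x y w)) \<in> tensor3_null s B"
    by (rule gen[where t = "\<lambda>w. tensor3 x y w"]) (use B in \<open>simp_all add: tensor3_null_relations\<close>)
qed

text \<open>Modulo \<open>tensor3_null\<close>, \<open>t\<close> is the combination of the tensors of spanning vectors
  whose coefficients are the evaluations of \<open>t\<close>.\<close>

lemma tensor3_nullI:
  fixes s :: "'k::field \<Rightarrow> 'b::ab_group_add \<Rightarrow> 'b"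
  assumes vs: "vector_space s" "module.subspace s B"
    and W: "finite W" "W \<subseteq> B"
    and coord: "\<And>x. x \<in> B \<Longrightarrow> x = (\<Sum>w\<in>W. s (c w x) w)"
    and keys: "Poly_Mapping.keys t \<subseteq> B \<times> B \<times> B"
    and eval: "\<And>u v w. u \<in> W \<Longrightarrow> v \<in> W \<Longrightarrow> w \<in> W \<Longrightarrow>
      free_eval (\<lambda>(x, y, z). c u x * c v y * c w z) t = 0"
  shows "t \<in> tensor3_null s B"
proof -
  interpret vector_space s by fact
  let ?N = "tensor3_null s B"
  define E where "E x y z = (\<Sum>u\<in>W. \<Sum>v\<in>W. \<Sum>w\<in>W. free_scale (c u x * c v y * c w z) (tensor3 u v w))"
    for x y z
  have E: "tensor3 x y z - E x y z \<in> ?N" if B: "x \<in> B" "y \<in> B" "z \<in> B" for x y z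
  proof -
    \<comment> \<open>The slots are expanded one after another: \<open>F\<close> expands the third,
      \<open>G\<close> also the second, and expanding the first gives \<open>E\<close>.\<close>
    define F where "F x y = (\<Sum>w\<in>W. free_scale (c w z) (tensor3 x y w))" for x y
    define G where "G x = (\<Sum>v\<in>W. free_scale (c v y) (F x v))" for x
    have 1: "tensor3 x' y' z - F x' y' \<in> ?N" if "x' \<in> B" "y' \<in> B" for x' y'
      using tensor3_multilinear(3)[OF vs W that, of "\<lambda>w. c w z"] coord[OF B(3)]
      unfolding F_def by simp
    have 2: "tensor3 x' y z - (\<Sum>v\<in>W. free_scale (c v y) (tensor3 x' v z)) \<in> ?N" if "x' \<in> B" for x'
      using tensor3_multilinear(2)[OF vs W that B(3), of "\<lambda>w. c w y"] coord[OF B(2)] by simp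
    have 3: "tensor3 x y z - (\<Sum>u\<in>W. free_scale (c u x) (tensor3 u y z)) \<in> ?N"
      using tensor3_multilinear(1)[OF vs W B(2,3), of "\<lambda>w. c w x"] coord[OF B(1)] by simp
    have 4: "tensor3 x' y z - G x' \<in> ?N" if "x' \<in> B" for x'
    proof -
      have "(\<Sum>v\<in>W. free_scale (c v y) (tensor3 x' v z - F x' v)) \<in> ?N"
        using 1[OF that] W(2) unfolding tensor3_null_def
        by (intro free.span_sum free.span_scale) auto
      with 2[OF that] have "(tensor3 x' y z - (\<Sum>v\<in>W. free_scale (c v y) (tensor3 x' v z)))
         + (\<Sum>v\<in>W. free_scale (c v y) (tensor3 x' v z - F x' v)) \<in> ?N"
        unfolding tensor3_null_def by (intro free.span_add)
      then show ?thesis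
        by (simp add: G_def free.scale_right_diff_distrib sum_subtractf)
    qed
    have "(\<Sum>u\<in>W. free_scale (c u x) (tensor3 u y z - G u)) \<in> ?N"
      using 4 W(2) unfolding tensor3_null_def
      by (intro free.span_sum free.span_scale) auto
    with 3 have "(tensor3 x y z - (\<Sum>u\<in>W. free_scale (c u x) (tensor3 u y z)))
         + (\<Sum>u\<in>W. free_scale (c u x) (tensor3 u y z - G u)) \<in> ?N"
      unfolding tensor3_null_def by (intro free.span_add)
    moreover have "(\<Sum>u\<in>W. free_scale (c u x) (G u)) = E x y z"
      by (simp add: E_def G_def F_def free.scale_sum_right mult.assoc)
    ultimately show ?thesis
      by (simp add: free.scale_right_diff_distrib sum_subtractf)
  qed
  let ?K = "Poly_Mapping.keys t"
  have "(\<Sum>k\<in>?K. free_scale (Poly_Mapping.lookup t k)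
      (tensor3 (fst k) (fst (snd k)) (snd (snd k)) - E (fst k) (fst (snd k)) (snd (snd k)))) \<in> ?N"
    using E keys unfolding tensor3_null_def
    by (intro free.span_sum free.span_scale) auto
  moreover have "t = (\<Sum>k\<in>?K. free_scale (Poly_Mapping.lookup t k)
      (tensor3 (fst k) (fst (snd k)) (snd (snd k))))"
    unfolding tensor3_def using free_expansion[of t] by simp
  moreover have "(\<Sum>k\<in>?K. free_scale (Poly_Mapping.lookup t k)
      (E (fst k) (fst (snd k)) (snd (snd k)))) = 0"
  proof -
    have "(\<Sum>k\<in>?K. free_scale (Poly_Mapping.lookup t k) (E (fst k) (fst (snd k)) (snd (snd k))))
      = (\<Sum>k\<in>?K. \<Sum>u\<in>W. \<Sum>v\<in>W. \<Sum>w\<in>W. free_scale (Poly_Mapping.lookup t k *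
          (c u (fst k) * c v (fst (snd k)) * c w (snd (snd k)))) (tensor3 u v w))"
      by (simp add: E_def free.scale_sum_right)
    \<comment> \<open>With the sum over the keys innermost, the coefficient of each
      \<open>tensor3 u v w\<close> becomes an evaluation of \<open>t\<close>, which
      \<open>eval\<close> makes zero.\<close>
    also have "\<dots> = (\<Sum>u\<in>W. \<Sum>v\<in>W. \<Sum>w\<in>W. \<Sum>k\<in>?K. free_scale (Poly_Mapping.lookup t k *
          (c u (fst k) * c v (fst (snd k)) * c w (snd (snd k)))) (tensor3 u v w))"
      by (subst sum.swap, rule sum.cong[OF refl], subst sum.swap, rule sum.cong[OF refl],
          rule sum.swap)
    also have "\<dots> = (\<Sum>u\<in>W. \<Sum>v\<in>W. \<Sum>w\<in>W.
        free_scale (free_eval (\<lambda>(x, y, z). c u x * c v y * c w z) t) (tensor3 u v w))"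
      by (simp add: free_eval_def free.scale_sum_left split_beta)
    also have "\<dots> = 0"
      by (simp add: eval)
    finally show ?thesis .
  qed
  ultimately show ?thesis
    by (simp add: free.scale_right_diff_distrib sum_subtractf)
qed

section \<open>The double of a Hom-L-dendriform algebra\<close>

text \<open>The standing data of the theorem; \<open>regular\<close> refers to the invertible
  twist.\<close>

locale regular_hom_L_dendriform_algebra =
  hom_L_dendriform_algebra scale rtri ltri \<alpha> + fin: finite_dimensional_vector_space scale V
  for scale :: "'k::field \<Rightarrow> 'a::ab_group_add \<Rightarrow> 'a"
    and rtri :: "'a \<Rightarrow> 'a \<Rightarrow> 'a" (infixl \<open>\<triangleright>\<close> 70)
    and ltri :: "'a \<Rightarrow> 'a \<Rightarrow> 'a" (infixl \<open>\<triangleleft>\<close> 70)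
    and \<alpha> :: "'a \<Rightarrow> 'a"
    and V :: "'a set" +
  assumes twist_bij: "bij \<alpha>"
begin

abbreviation dual :: "('a \<Rightarrow> 'k) set"
  where "dual \<equiv> dual_space scale UNIV"

abbreviation \<beta> :: "'a \<Rightarrow> 'a"
  where "\<beta> \<equiv> inv \<alpha>"

abbreviation dvec :: "'a \<Rightarrow> 'a \<Rightarrow> 'k"
  where "dvec \<equiv> dual_vec scale V"

abbreviation B :: "('a \<times> ('a \<Rightarrow> 'k)) set"
  where "B \<equiv> double_space scale"

abbreviation S :: "'k \<Rightarrow> 'a \<times> ('a \<Rightarrow> 'k) \<Rightarrow> 'a \<times> ('a \<Rightarrow> 'k)"
  where "S \<equiv> double_scale scale"

abbreviation mult :: "'a \<times> ('a \<Rightarrow> 'k) \<Rightarrow> 'a \<times> ('a \<Rightarrow> 'k) \<Rightarrow> 'a \<times> ('a \<Rightarrow> 'k)" (infixl \<open>\<bullet>\<close> 70)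
  where "mult \<equiv> double_mult rtri ltri \<alpha>"

abbreviation \<gamma> :: "'a \<times> ('a \<Rightarrow> 'k) \<Rightarrow> 'a \<times> ('a \<Rightarrow> 'k)"
  where "\<gamma> \<equiv> double_twist \<alpha>"

section \<open>Functionals, the inverse twist and the product in explicit form\<close>

lemma dual_iff:
  "\<xi> \<in> dual \<longleftrightarrow> (\<forall>x y. \<xi> (x + y) = \<xi> x + \<xi> y) \<and> (\<forall>c x. \<xi> (scale c x) = c * \<xi> x)"
  by (simp add: dual_space_def linear_map_on_def)

lemma dual_simps:
  assumes "\<xi> \<in> dual"
  shows "\<xi> (x + y) = \<xi> x + \<xi> y" "\<xi> (scale c x) = c * \<xi> x" "\<xi> 0 = 0"
    "\<xi> (- x) = - \<xi> x" "\<xi> (x - y) = \<xi> x - \<xi> y"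
proof -
  show add: "\<xi> (x + y) = \<xi> x + \<xi> y" and scl: "\<xi> (scale c x) = c * \<xi> x" for x y c
    using assms by (auto simp: dual_iff)
  show zero: "\<xi> 0 = 0"
    using scl[of 0 0] by simp
  show "\<xi> (- x) = - \<xi> x"
    using scl[of "-1" x] by simp
  then show "\<xi> (x - y) = \<xi> x - \<xi> y"
    using add[of x "- y"] scl[of "-1" y] by simp
qed

lemma dual_sum: "\<xi> \<in> dual \<Longrightarrow> \<xi> (\<Sum>i\<in>I. x i) = (\<Sum>i\<in>I. \<xi> (x i))"
  by (induction I rule: infinite_finite_induct) (simp_all add: dual_simps)

lemma twist_inv [simp]: "\<alpha> (\<beta> x) = x" "\<beta> (\<alpha> x) = x"
  using twist_bij by (simp_all add: bij_is_surj surj_f_inv_f bij_is_inj)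

lemma twist_eq: "\<alpha> x = y \<Longrightarrow> \<beta> y = x"
  using twist_inv(2) by blast

lemma twist_simps:
  "\<alpha> (x + y) = \<alpha> x + \<alpha> y" "\<alpha> (x - y) = \<alpha> x - \<alpha> y" "\<alpha> (scale c x) = scale c (\<alpha> x)"
proof -
  interpret l: Vector_Spaces.linear scale scale \<alpha> by (rule twist_linear)
  show "\<alpha> (x + y) = \<alpha> x + \<alpha> y" "\<alpha> (x - y) = \<alpha> x - \<alpha> y" "\<alpha> (scale c x) = scale c (\<alpha> x)"
    by (rule l.add l.diff l.scale)+
qed

text \<open>The inverse of a bijective endomorphism is again an endomorphism: by
  \<open>twist_eq\<close>, each equation reduces to one for \<alpha>.\<close>

lemma inv_simps:
  "\<beta> (x + y) = \<beta> x + \<beta> y" "\<beta> (x - y) = \<beta> x - \<beta> y" "\<beta> (scale c x) = scale c (\<beta> x)"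
  "\<beta> (x \<triangleright> y) = \<beta> x \<triangleright> \<beta> y" "\<beta> (x \<triangleleft> y) = \<beta> x \<triangleleft> \<beta> y"
  by (rule twist_eq; simp add: twist_simps twist_rtri twist_ltri)+

lemma tri_simps:
  "(x + y) \<triangleright> z = x \<triangleright> z + y \<triangleright> z" "x \<triangleright> (y + z) = x \<triangleright> y + x \<triangleright> z"
  "(x - y) \<triangleright> z = x \<triangleright> z - y \<triangleright> z" "x \<triangleright> (y - z) = x \<triangleright> y - x \<triangleright> z"
  "scale c x \<triangleright> z = scale c (x \<triangleright> z)" "x \<triangleright> scale c z = scale c (x \<triangleright> z)"
  "(x + y) \<triangleleft> z = x \<triangleleft> z + y \<triangleleft> z" "x \<triangleleft> (y + z) = x \<triangleleft> y + x \<triangleleft> z"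
  "(x - y) \<triangleleft> z = x \<triangleleft> z - y \<triangleleft> z" "x \<triangleleft> (y - z) = x \<triangleleft> y - x \<triangleleft> z"
  "scale c x \<triangleleft> z = scale c (x \<triangleleft> z)" "x \<triangleleft> scale c z = scale c (x \<triangleleft> z)"
proof -
  interpret a: Vector_Spaces.linear scale scale "\<lambda>x. x \<triangleright> y" for y by (rule rtri_linear_left)
  interpret b: Vector_Spaces.linear scale scale "\<lambda>y. x \<triangleright> y" for x by (rule rtri_linear_right)
  interpret c: Vector_Spaces.linear scale scale "\<lambda>x. x \<triangleleft> y" for y by (rule ltri_linear_left)
  interpret d: Vector_Spaces.linear scale scale "\<lambda>y. x \<triangleleft> y" for x by (rule ltri_linear_right)
  show "(x + y) \<triangleright> z = x \<triangleright> z + y \<triangleright> z" "x \<triangleright> (y + z) = x \<triangleright> y + x \<triangleright> z"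
    "(x - y) \<triangleright> z = x \<triangleright> z - y \<triangleright> z" "x \<triangleright> (y - z) = x \<triangleright> y - x \<triangleright> z"
    "scale c x \<triangleright> z = scale c (x \<triangleright> z)" "x \<triangleright> scale c z = scale c (x \<triangleright> z)"
    "(x + y) \<triangleleft> z = x \<triangleleft> z + y \<triangleleft> z" "x \<triangleleft> (y + z) = x \<triangleleft> y + x \<triangleleft> z"
    "(x - y) \<triangleleft> z = x \<triangleleft> z - y \<triangleleft> z" "x \<triangleleft> (y - z) = x \<triangleleft> y - x \<triangleleft> z"
    "scale c x \<triangleleft> z = scale c (x \<triangleleft> z)" "x \<triangleleft> scale c z = scale c (x \<triangleleft> z)"
    by (rule a.add b.add c.add d.add a.diff b.diff c.diff d.diff a.scale b.scale c.scale d.scale)+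
qed

text \<open>Since \<beta> respects both products, the two inverse twists in the star action turn
  \<open>\<alpha> x\<close> into \<open>\<beta> x\<close> and the argument \<open>w\<close> into
  \<open>\<beta> (\<beta> w)\<close>. All later computations in the double start from this
  form.\<close>

lemma mult_eq:
  "(x, \<xi>) \<bullet> (y, \<eta>) = (x \<triangleright> y - y \<triangleleft> x,
    \<lambda>w. - \<eta> (\<beta> x \<triangleright> \<beta> (\<beta> w)) - \<eta> (\<beta> x \<triangleleft> \<beta> (\<beta> w)) - \<xi> (\<beta> y \<triangleleft> \<beta> (\<beta> w)))"
  by (simp add: double_mult_def semidirect_mult_def vertical_mult_def star_action_def
      dual_action_def dual_map_def fun_eq_iff inv_simps numeral_2_eq_2)

lemma twist_eq_pair: "\<gamma> (x, \<xi>) = (\<alpha> x, \<lambda>w. \<xi> (\<beta> w))"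
  by (simp add: double_twist_def dual_map_def)

lemma mem_B [simp]: "(x, \<xi>) \<in> B \<longleftrightarrow> \<xi> \<in> dual"
  by (simp add: double_space_def)

section \<open>The double as a vector space and as a Hom-pre-Lie algebra\<close>

lemma S_eq: "S c (x, \<xi>) = (scale c x, \<lambda>y. c * \<xi> y)"
  by (simp add: double_scale_def)

lemma vector_space_S: "vector_space S"
  by unfold_locales (auto simp: S_eq algebra_simps fun_eq_iff)

sublocale D: vector_space S
  by (rule vector_space_S)

lemma subspace_B: "D.subspace B"
  by (auto simp: D.subspace_def zero_prod_def S_eq dual_iff algebra_simps)

text \<open>\<open>dendriform1\<close> at (x, y, z) plus \<open>dendriform2\<close> at (x, y, z)
  minus \<open>dendriform2\<close> at (y, x, z). In terms of the operators \<open>\<rho> x =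
  L\<^sub>\<triangleright> x + L\<^sub>\<triangleleft> x\<close> this is the representation law
  \<open>\<rho> [x, y] \<alpha> = \<rho> (\<alpha> x) \<rho> y - \<rho> (\<alpha> y) \<rho>
  x\<close> for the commutator of the vertical product.\<close>

lemma commutator_rep:
  "(x \<triangleright> y - y \<triangleleft> x) \<triangleright> \<alpha> z + (x \<triangleright> y - y \<triangleleft> x) \<triangleleft> \<alpha> z
   - ((y \<triangleright> x - x \<triangleleft> y) \<triangleright> \<alpha> z + (y \<triangleright> x - x \<triangleleft> y) \<triangleleft> \<alpha> z)
   = \<alpha> x \<triangleright> (y \<triangleright> z + y \<triangleleft> z) + \<alpha> x \<triangleleft> (y \<triangleright> z + y \<triangleleft> z)
   - (\<alpha> y \<triangleright> (x \<triangleright> z + x \<triangleleft> z) + \<alpha> y \<triangleleft> (x \<triangleright> z + x \<triangleleft> z))" (is "?l = ?r")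
proof -
  have "?l - ?r = ((x \<triangleright> y) \<triangleright> \<alpha> z + (x \<triangleleft> y) \<triangleright> \<alpha> z + \<alpha> y \<triangleright> (x \<triangleright> z)
      - (y \<triangleleft> x) \<triangleright> \<alpha> z - (y \<triangleright> x) \<triangleright> \<alpha> z - \<alpha> x \<triangleright> (y \<triangleright> z))
    + ((x \<triangleright> y) \<triangleleft> \<alpha> z + \<alpha> y \<triangleleft> (x \<triangleright> z) + \<alpha> y \<triangleleft> (x \<triangleleft> z)
      - (y \<triangleleft> x) \<triangleleft> \<alpha> z - \<alpha> x \<triangleright> (y \<triangleleft> z))
    - ((y \<triangleright> x) \<triangleleft> \<alpha> z + \<alpha> x \<triangleleft> (y \<triangleright> z) + \<alpha> x \<triangleleft> (y \<triangleleft> z)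
      - (x \<triangleleft> y) \<triangleleft> \<alpha> z - \<alpha> y \<triangleright> (x \<triangleleft> z))"
    by (simp add: tri_simps algebra_simps)
  also have "\<dots> = 0"
    by (simp only: dendriform1 dendriform2 add_0_right diff_zero)
  finally show ?thesis by simp
qed

text \<open>\<open>dendriform1\<close> at (x, y, z) plus \<open>dendriform2\<close> at (y, z, x)
  minus \<open>dendriform2\<close> at (x, z, y).\<close>

lemma vertical_hom_pre_Lie:
  fixes x y z
  defines "m \<equiv> vertical_mult (\<triangleright>) (\<triangleleft>)"
  shows "m (m x y) (\<alpha> z) - m (\<alpha> x) (m y z) = m (m y x) (\<alpha> z) - m (\<alpha> y) (m x z)" (is "?l = ?r")
proof -
  have "?l - ?r = ((x \<triangleright> y) \<triangleright> \<alpha> z + (x \<triangleleft> y) \<triangleright> \<alpha> z + \<alpha> y \<triangleright> (x \<triangleright> z)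
      - (y \<triangleleft> x) \<triangleright> \<alpha> z - (y \<triangleright> x) \<triangleright> \<alpha> z - \<alpha> x \<triangleright> (y \<triangleright> z))
    + ((y \<triangleright> z) \<triangleleft> \<alpha> x + \<alpha> z \<triangleleft> (y \<triangleright> x) + \<alpha> z \<triangleleft> (y \<triangleleft> x)
      - (z \<triangleleft> y) \<triangleleft> \<alpha> x - \<alpha> y \<triangleright> (z \<triangleleft> x))
    - ((x \<triangleright> z) \<triangleleft> \<alpha> y + \<alpha> z \<triangleleft> (x \<triangleright> y) + \<alpha> z \<triangleleft> (x \<triangleleft> y)
      - (z \<triangleleft> x) \<triangleleft> \<alpha> y - \<alpha> x \<triangleright> (z \<triangleleft> y))"
    unfolding m_def vertical_mult_def
    by (simp add: tri_simps algebra_simps)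
  also have "\<dots> = 0"
    by (simp only: dendriform1 dendriform2 add_0_right diff_zero)
  finally show ?thesis by simp
qed

text \<open>The vector component is the identity of the vertical algebra. The functional component
  splits according to the functional that occurs: the \<zeta> part is \<open>commutator_rep\<close>,
  the \<eta> and \<xi> parts are each an instance of \<open>dendriform2\<close>.\<close>

lemma double_hom_pre_Lie: "hom_pre_Lie_algebra S B mult \<gamma>"
proof (intro hom_pre_Lie_algebra.intro hom_pre_Lie_algebra_axioms.intro vector_space_S subspace_B)
  fix p q r assume "p \<in> B" "q \<in> B" "r \<in> B"
  then obtain x \<xi> y \<eta> z \<zeta> where pqr: "p = (x, \<xi>)" "q = (y, \<eta>)" "r = (z, \<zeta>)"
    and dual: "\<xi> \<in> dual" "\<eta> \<in> dual" "\<zeta> \<in> dual"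
    by (metis mem_B surj_pair)
  note ds = dual_simps[OF dual(1)] dual_simps[OF dual(2)] dual_simps[OF dual(3)]
  show "(p \<bullet> q) \<bullet> \<gamma> r - \<gamma> p \<bullet> (q \<bullet> r) = (q \<bullet> p) \<bullet> \<gamma> r - \<gamma> q \<bullet> (p \<bullet> r)"
  proof (rule prod_eqI)
    show "fst ((p \<bullet> q) \<bullet> \<gamma> r - \<gamma> p \<bullet> (q \<bullet> r)) = fst ((q \<bullet> p) \<bullet> \<gamma> r - \<gamma> q \<bullet> (p \<bullet> r))"
      using vertical_hom_pre_Lie[of x y z]
      by (simp add: pqr mult_eq twist_eq_pair vertical_mult_def)
    show "snd ((p \<bullet> q) \<bullet> \<gamma> r - \<gamma> p \<bullet> (q \<bullet> r)) = snd ((q \<bullet> p) \<bullet> \<gamma> r - \<gamma> q \<bullet> (p \<bullet> r))"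
    proof
      fix w
      \<comment> \<open>Two nested actions put up to two inverse twists on \<open>x\<close>,
        \<open>y\<close>, \<open>z\<close> and up to four on \<open>w\<close>. In the new variables
        only the occurrences of \<alpha> seen in the axioms remain.\<close>
      define X Y Z W where "X = \<beta> (\<beta> x)" and "Y = \<beta> (\<beta> y)" and "Z = \<beta> (\<beta> z)"
        and "W = \<beta> (\<beta> (\<beta> (\<beta> w)))"
      have inv: "\<beta> x = \<alpha> X" "\<beta> y = \<alpha> Y" "\<beta> z = \<alpha> Z" "\<beta> (\<beta> (\<beta> w)) = \<alpha> W"
        by (simp_all add: X_def Y_def Z_def W_def)
      have e1: "\<zeta> ((X \<triangleright> Y - Y \<triangleleft> X) \<triangleright> \<alpha> W + (X \<triangleright> Y - Y \<triangleleft> X) \<triangleleft> \<alpha> W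
           - ((Y \<triangleright> X - X \<triangleleft> Y) \<triangleright> \<alpha> W + (Y \<triangleright> X - X \<triangleleft> Y) \<triangleleft> \<alpha> W))
        = \<zeta> (\<alpha> X \<triangleright> (Y \<triangleright> W + Y \<triangleleft> W) + \<alpha> X \<triangleleft> (Y \<triangleright> W + Y \<triangleleft> W)
           - (\<alpha> Y \<triangleright> (X \<triangleright> W + X \<triangleleft> W) + \<alpha> Y \<triangleleft> (X \<triangleright> W + X \<triangleleft> W)))"
        by (simp only: commutator_rep)
      have e2: "\<eta> ((X \<triangleright> Z) \<triangleleft> \<alpha> W + \<alpha> Z \<triangleleft> (X \<triangleright> W) + \<alpha> Z \<triangleleft> (X \<triangleleft> W)
          - (Z \<triangleleft> X) \<triangleleft> \<alpha> W - \<alpha> X \<triangleright> (Z \<triangleleft> W)) = 0"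
        by (simp only: dendriform2 ds)
      have e3: "\<xi> ((Y \<triangleright> Z) \<triangleleft> \<alpha> W + \<alpha> Z \<triangleleft> (Y \<triangleright> W) + \<alpha> Z \<triangleleft> (Y \<triangleleft> W)
          - (Z \<triangleleft> Y) \<triangleleft> \<alpha> W - \<alpha> Y \<triangleright> (Z \<triangleleft> W)) = 0"
        by (simp only: dendriform2 ds)
      show "snd ((p \<bullet> q) \<bullet> \<gamma> r - \<gamma> p \<bullet> (q \<bullet> r)) w = snd ((q \<bullet> p) \<bullet> \<gamma> r - \<gamma> q \<bullet> (p \<bullet> r)) w"
        using e1 e2 e3
        apply (simp add: pqr mult_eq twist_eq_pair inv_simps tri_simps ds)
        apply (simp add: inv X_def[symmetric] Y_def[symmetric] Z_def[symmetric] W_def[symmetric])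
        by algebra
    qed
  qed
qed (auto simp: linear_map_on_def mult_eq twist_eq_pair S_eq dual_iff inv_simps tri_simps
    twist_simps twist_rtri twist_ltri fun_eq_iff algebra_simps)

lemma twist_bij_B: "bij_betw \<gamma> B B"
  by (rule bij_betw_byWitness[where f' = "\<lambda>(x, \<xi>). (\<beta> x, \<lambda>w. \<xi> (\<alpha> w))"])
    (auto simp: twist_eq_pair dual_iff inv_simps twist_simps double_space_def)

section \<open>Dual bases and the tensor \<open>r\<close>\<close>

lemma zero_dual: "0 \<in> dual"
  by (simp add: dual_iff)

lemma dvec_dual: "dvec v \<in> dual"
  by (simp add: dual_iff dual_vec_def representation_add representation_scale
      fin.independent_Basis fin.span_Basis)

lemma dvec_expansion: "(\<Sum>v\<in>V. scale (dvec v x) v) = x"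
  unfolding dual_vec_def
  by (rule sum_representation_eq) (simp_all add: fin.independent_Basis fin.span_Basis fin.finite_Basis)

lemma dual_expansion:
  assumes "\<xi> \<in> dual"
  shows "(\<Sum>v\<in>V. \<xi> v * dvec v x) = \<xi> x"
  using arg_cong[OF dvec_expansion[of x], of \<xi>] assms
  by (simp add: dual_sum dual_simps mult.commute)

definition r :: "('a \<times> ('a \<Rightarrow> 'k)) \<times> ('a \<times> ('a \<Rightarrow> 'k)) \<Rightarrow>\<^sub>0 'k"
  where "r = (\<Sum>v\<in>V. tensor2 (v, 0) (0, dvec v) + tensor2 (0, dvec v) (v, 0))"

lemma zero_notin_V: "0 \<notin> V"
  using dependent_zero fin.independent_Basis by blast

text \<open>The summands of \<open>r\<close> are distinct generators: \<open>0 \<notin> V\<close>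
  separates the two families, and \<open>v\<close> can be read off from each key. Hence no
  coefficients add up, and sums over the keys become sums over \<open>V\<close>.\<close>

lemma
  keys_r: "Poly_Mapping.keys r = (\<lambda>v. ((v, 0), (0, dvec v))) ` V \<union> (\<lambda>v. ((0, dvec v), (v, 0))) ` V"
      (is "_ = ?K1 \<union> ?K2")
    and lookup_r: "k \<in> Poly_Mapping.keys r \<Longrightarrow> Poly_Mapping.lookup r k = 1"
    and sum_keys_r: "(\<Sum>k\<in>Poly_Mapping.keys r. h k) =
      (\<Sum>v\<in>V. h ((v, 0), (0, dvec v)) + h ((0, dvec v), (v, 0)))"
proof -
  have disj: "?K1 \<inter> ?K2 = {}"
    using zero_notin_V by auto
  have inj: "inj_on (\<lambda>v. ((v, 0), (0, dvec v))) V" "inj_on (\<lambda>v. ((0, dvec v), (v, 0))) V"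
    by (auto simp: inj_on_def)
  \<comment> \<open>Polymorphic in the target, since it serves both for \<open>r\<close> itself, a
    sum in the free space, and for the arbitrary \<open>h\<close> of the last claim.\<close>
  have sum: "(\<Sum>k\<in>?K1 \<union> ?K2. g k) =
      (\<Sum>v\<in>V. g ((v, 0), (0, dvec v)) + g ((0, dvec v), (v, 0)))"
    for g :: "_ \<Rightarrow> 'z::comm_monoid_add"
    using disj fin.finite_Basis
    by (simp add: sum.union_disjoint sum.reindex[OF inj(1)] sum.reindex[OF inj(2)] sum.distrib)
  have "r = (\<Sum>k\<in>?K1 \<union> ?K2. Poly_Mapping.single k 1)"
    unfolding sum by (simp add: r_def tensor2_def)
  then have lookup: "Poly_Mapping.lookup r k = (if k \<in> ?K1 \<union> ?K2 then 1 else 0)" for k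
    using fin.finite_Basis
    by (simp add: lookup_sum lookup_single when_def del: Un_iff)
  then show keys: "Poly_Mapping.keys r = ?K1 \<union> ?K2"
    by (intro set_eqI) (simp add: in_keys_iff del: Un_iff)
  show "k \<in> Poly_Mapping.keys r \<Longrightarrow> Poly_Mapping.lookup r k = 1"
    unfolding keys by (simp add: lookup del: Un_iff)
  show "(\<Sum>k\<in>Poly_Mapping.keys r. h k) =
      (\<Sum>v\<in>V. h ((v, 0), (0, dvec v)) + h ((0, dvec v), (v, 0)))"
    unfolding keys by (rule sum)
qed

lemma keys_r_B: "Poly_Mapping.keys r \<subseteq> B \<times> B"
  unfolding keys_r using dvec_dual by (auto simp: dual_iff)

text \<open>Flipping exchanges the two summands belonging to each \<open>v\<close>, so symmetry
  holds already in the free space, before passing to the quotient.\<close>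

lemma flip_r: "tensor2_flip r = r"
proof -
  have "tensor2_flip r = (\<Sum>k\<in>Poly_Mapping.keys r. tensor2 (snd k) (fst k))"
    unfolding tensor2_flip_def by (rule sum.cong) (auto simp: lookup_r)
  then show ?thesis
    unfolding sum_keys_r by (simp add: r_def add.commute)
qed

section \<open>The canonical form and contraction of \<open>r\<close> with it\<close>

definition \<omega> :: "'a \<times> ('a \<Rightarrow> 'k) \<Rightarrow> 'a \<times> ('a \<Rightarrow> 'k) \<Rightarrow> 'k"
  where "\<omega> a b = snd a (fst b) + snd b (fst a)"

lemma \<omega>_linear: "a \<in> B \<Longrightarrow> linear_map_on S (*) B (\<omega> a)"
  by (cases a) (auto simp: linear_map_on_def \<omega>_def S_eq dual_simps algebra_simps)

lemma \<omega>_twist: "\<omega> (\<gamma> a) (\<gamma> b) = \<omega> a b"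
  by (cases a; cases b) (simp add: \<omega>_def twist_eq_pair)

lemma \<omega>_commute: "\<omega> a b = \<omega> b a"
  by (simp add: \<omega>_def add.commute)

text \<open>For \<open>a = (w, u)\<close> the form yields the coordinates \<open>u v\<close> and
  \<open>dvec v w\<close>. By linearity of \<open>h\<close> the two sums reassemble to
  \<open>h (0, u)\<close> and \<open>h (w, 0)\<close>.\<close>

lemma r_contract:
  assumes a: "a \<in> B" and h: "linear_map_on S (*) B h"
  shows "(\<Sum>(x, y)\<in>Poly_Mapping.keys r. \<omega> a x * h y) = h a"
proof -
  obtain w u where wu: "a = (w, u)" and u: "u \<in> dual"
    using a by (cases a) auto
  have 1: "h (\<Sum>v\<in>V. S (u v) (0, dvec v)) = (\<Sum>v\<in>V. u v * h (0, dvec v))"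
    using linear_map_on_sum[OF vector_space_S subspace_B h fin.finite_Basis, of "\<lambda>v. (0, dvec v)"]
    by (simp add: dvec_dual)
  have 2: "h (\<Sum>v\<in>V. S (dvec v w) (v, 0)) = (\<Sum>v\<in>V. dvec v w * h (v, 0))"
    using linear_map_on_sum[OF vector_space_S subspace_B h fin.finite_Basis, of "\<lambda>v. (v, 0)"]
    by (simp add: zero_dual)
  have 3: "(\<Sum>v\<in>V. S (u v) (0, dvec v)) = (0, u)"
    by (rule prod_eqI) (auto simp: fst_sum snd_sum S_eq fun_eq_iff sum_apply dual_expansion[OF u])
  have 4: "(\<Sum>v\<in>V. S (dvec v w) (v, 0)) = (w, 0)"
    by (rule prod_eqI) (auto simp: fst_sum snd_sum S_eq fun_eq_iff sum_apply dvec_expansion)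
  have "(\<Sum>(x, y)\<in>Poly_Mapping.keys r. \<omega> a x * h y) = h (0, u) + h (w, 0)"
    unfolding sum_keys_r using 1 2 3 4 by (simp add: \<omega>_def wu sum.distrib dual_simps[OF u])
  also have "\<dots> = h ((0, u) + (w, 0))"
    using h u zero_dual unfolding linear_map_on_def by (metis mem_B)
  finally show ?thesis by (simp add: wu)
qed

lemma r_contract':
  assumes a: "a \<in> B" and h: "linear_map_on S (*) B h"
  shows "(\<Sum>(x, y)\<in>Poly_Mapping.keys r. \<omega> a y * h x) = h a"
  using r_contract[OF a h] unfolding sum_keys_r by (simp add: add.commute)

text \<open>The vectors \<open>(v, 0)\<close> and \<open>(0, dvec v)\<close> form a basis of the
  double, and \<omega> pairs each of them with its partner in the other family; so the partner reads
  off the coordinate.\<close>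

lemma B_expansion:
  assumes "a \<in> B"
  shows "a = (\<Sum>v\<in>V. S (\<omega> (0, dvec v) a) (v, 0) + S (\<omega> (v, 0) a) (0, dvec v))"
  using assms
  by (cases a) (auto intro!: prod_eqI simp: \<omega>_def sum.distrib fst_sum snd_sum S_eq fun_eq_iff
      sum_apply dvec_expansion dual_expansion dual_simps)

lemma \<omega>_nondegenerate:
  assumes "b \<in> B" "b' \<in> B" "\<And>a. a \<in> B \<Longrightarrow> \<omega> a b = \<omega> a b'"
  shows "b = b'"
proof -
  have "\<omega> (0, dvec v) b = \<omega> (0, dvec v) b'" "\<omega> (v, 0) b = \<omega> (v, 0) b'" for v
    by (rule assms(3), simp add: dvec_dual zero_dual)+
  then show ?thesis
    using B_expansion[OF assms(1)] B_expansion[OF assms(2)] by simp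
qed

section \<open>The map from functionals to vectors given by \<open>r\<close>\<close>

lemma dual_\<omega>: "a \<in> B \<Longrightarrow> (\<lambda>x. if x \<in> B then \<omega> a x else 0) \<in> dual_space S B"
  using \<omega>_linear[of a] D.subspace_add[OF subspace_B] D.subspace_scale[OF subspace_B]
  by (auto simp: dual_space_def linear_map_on_def)

text \<open>By \<open>r_contract\<close> the vector \<open>b\<close> meets the condition defining
  \<open>sharp\<close>; nondegeneracy of \<omega> supplies the uniqueness that \<open>THE\<close>
  requires.\<close>

lemma sharp_\<omega>:
  assumes b: "b \<in> B" and \<xi>: "\<And>x. x \<in> B \<Longrightarrow> \<xi> x = \<omega> b x"
  shows "sharp S B r \<xi> = b"
proof -
  have pairing: "tensor2_pairing r \<xi> \<eta> = \<eta> b" if "\<eta> \<in> dual_space S B" for \<eta>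
  proof -
    have "tensor2_pairing r \<xi> \<eta> = (\<Sum>(x, y)\<in>Poly_Mapping.keys r. \<omega> b x * \<eta> y)"
      unfolding tensor2_pairing_def
      by (rule sum.cong) (use keys_r_B \<xi> in \<open>auto simp: lookup_r\<close>)
    then show ?thesis
      using r_contract[OF b] that by (simp add: dual_space_def)
  qed
  show ?thesis
    unfolding sharp_def
  proof (rule the_equality)
    fix b' assume b': "b' \<in> B \<and> (\<forall>\<eta>\<in>dual_space S B. \<eta> b' = tensor2_pairing r \<xi> \<eta>)"
    show "b' = b"
    proof (rule \<omega>_nondegenerate)
      fix a assume "a \<in> B"
      from dual_\<omega>[OF this] show "\<omega> a b' = \<omega> a b"
        using b b' pairing by fastforce
    qed (use b b' in auto)
  qed (simp add: b pairing)
qed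

lemma \<omega>_represents:
  assumes "\<xi> \<in> dual_space S B"
  obtains b where "b \<in> B" "\<And>x. x \<in> B \<Longrightarrow> \<xi> x = \<omega> b x"
proof -
  have lin: "linear_map_on S (*) B \<xi>"
    using assms by (simp add: dual_space_def)
  \<comment> \<open>The contraction of the first leg of \<open>r\<close> with \<xi>, that is, the
    expected value of \<open>sharp\<close> at \<xi>. Pairing it with \<open>x\<close> contracts the
    second leg with \<open>\<omega> x\<close> and leaves \<open>\<xi> x\<close>.\<close>
  define b where "b = (\<Sum>(x, y)\<in>Poly_Mapping.keys r. S (\<xi> x) y)"
  have "b \<in> B"
    unfolding b_def using keys_r_B
    by (intro D.subspace_sum[OF subspace_B]) (auto intro: D.subspace_scale[OF subspace_B])
  moreover have "\<xi> x = \<omega> b x" if x: "x \<in> B" for x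
  proof -
    have "\<omega> b x = \<omega> x (\<Sum>k\<in>Poly_Mapping.keys r. S (\<xi> (fst k)) (snd k))"
      by (simp add: \<omega>_commute b_def split_beta)
    also have "\<dots> = (\<Sum>k\<in>Poly_Mapping.keys r. \<xi> (fst k) * \<omega> x (snd k))"
      using keys_r_B by (intro linear_map_on_sum[OF vector_space_S subspace_B \<omega>_linear[OF x]]) auto
    also have "\<dots> = (\<Sum>(x', y)\<in>Poly_Mapping.keys r. \<omega> x y * \<xi> x')"
      by (simp add: split_beta mult.commute)
    also have "\<dots> = \<xi> x"
      by (rule r_contract'[OF x lin])
    finally show ?thesis by simp
  qed
  ultimately show ?thesis by (rule that)
qed

text \<open>If \<xi> is \<open>\<omega> b\<close> on \<open>B\<close>, then orthogonality of
  \<gamma> turns \<xi> composed with the inverse of \<gamma> into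
  \<open>\<omega> (\<gamma> b)\<close>, so \<open>sharp_\<omega>\<close> computes both
  sides.\<close>

lemma sharp_twist:
  assumes "\<xi> \<in> dual_space S B"
  shows "sharp S B r (dual_map B (inv_into B \<gamma>) \<xi>) = \<gamma> (sharp S B r \<xi>)"
proof -
  obtain b where b: "b \<in> B" "\<And>x. x \<in> B \<Longrightarrow> \<xi> x = \<omega> b x"
    using \<omega>_represents[OF assms] by blast
  have "sharp S B r (dual_map B (inv_into B \<gamma>) \<xi>) = \<gamma> b"
  proof (rule sharp_\<omega>)
    show "\<gamma> b \<in> B"
      using b(1) twist_bij_B by (auto dest: bij_betwE)
    fix x assume x: "x \<in> B"
    then have "inv_into B \<gamma> x \<in> B" "\<gamma> (inv_into B \<gamma> x) = x"
      using twist_bij_B by (auto simp: bij_betw_def inv_into_into f_inv_into_f)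
    then show "dual_map B (inv_into B \<gamma>) \<xi> x = \<omega> (\<gamma> b) x"
      using x b(2) \<omega>_twist[of b "inv_into B \<gamma> x"] by (simp add: dual_map_def)
  qed
  then show ?thesis
    using sharp_\<omega>[OF b] by simp
qed

section \<open>Vanishing of the bracket of \<open>r\<close> with itself\<close>

text \<open>Expanded by \<open>mult_eq\<close>, every summand is one of the three functionals
  applied to a product of two vectors \<open>\<beta> x1\<close>, \<open>\<beta> x2\<close>,
  \<open>\<beta> x3\<close>, and the summands cancel in pairs.\<close>

lemma \<omega>_bracket:
  assumes "a \<in> B" "b \<in> B" "c \<in> B"
  shows "\<omega> (\<gamma> b) (commutator mult a c) - \<omega> (\<gamma> a) (c \<bullet> b) + \<omega> (\<gamma> c) (a \<bullet> b) = 0"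
proof -
  obtain x1 \<xi>1 x2 \<xi>2 x3 \<xi>3 where abc: "a = (x1, \<xi>1)" "b = (x2, \<xi>2)" "c = (x3, \<xi>3)"
    and dual: "\<xi>1 \<in> dual" "\<xi>2 \<in> dual" "\<xi>3 \<in> dual"
    using assms by (metis mem_B surj_pair)
  show ?thesis
    by (simp add: abc commutator_def \<omega>_def mult_eq twist_eq_pair inv_simps
        dual_simps[OF dual(1)] dual_simps[OF dual(2)] dual_simps[OF dual(3)])
qed

text \<open>Testing against \<gamma>-images lets \<open>\<omega>_twist\<close> strip \<gamma> from
  the legs without a product. These legs are then contracted, the inner sum using up the second copy
  of \<open>r\<close> and the outer sum the first.\<close>

lemma bracket_eval:
  assumes a: "a \<in> B" "b \<in> B" "c \<in> B"
  shows "free_eval (\<lambda>(x, y, z). \<omega> (\<gamma> a) x * \<omega> (\<gamma> b) y * \<omega> (\<gamma> c) z) (tensor_bracket mult \<gamma> r) = 0"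
proof -
  interpret L: hom_pre_Lie_algebra S B mult \<gamma>
    by (rule double_hom_pre_Lie)
  let ?P = "Poly_Mapping.keys r"
  have \<gamma>B: "\<gamma> a \<in> B" "\<gamma> b \<in> B" "\<gamma> c \<in> B"
    using a by (auto intro: L.twist_closed)
  \<comment> \<open>The legs containing a product play the role of \<open>h\<close> in the
    contractions, so they must be linear in each argument.\<close>
  have linL: "linear_map_on S (*) B (\<lambda>x. \<omega> d (x \<bullet> y))" if "d \<in> B" "y \<in> B" for d y
    using \<omega>_linear[OF that(1)] L.mult_linear_left[OF that(2)] L.mult_closed[OF _ that(2)]
    by (auto simp: linear_map_on_def)
  have linR: "linear_map_on S (*) B (\<lambda>y. \<omega> d (x \<bullet> y))" if "d \<in> B" "x \<in> B" for d x
    using \<omega>_linear[OF that(1)] L.mult_linear_right[OF that(2)] L.mult_closed[OF that(2)]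
    by (auto simp: linear_map_on_def)
  have comm: "\<omega> d (commutator mult x y) = \<omega> d (x \<bullet> y) - \<omega> d (y \<bullet> x)" if "d \<in> B" for d x y
    using that by (cases d) (simp add: commutator_def \<omega>_def dual_simps)
  have linC: "linear_map_on S (*) B (\<lambda>y. \<omega> d (commutator mult x y))"
    "linear_map_on S (*) B (\<lambda>y. \<omega> d (commutator mult y x))" if "d \<in> B" "x \<in> B" for d x
    using linL[OF that] linR[OF that] unfolding comm[OF that(1)] by (auto simp: linear_map_on_def algebra_simps)
  \<comment> \<open>The contractions put \<open>c\<close> for \<open>x'\<close> in the first term,
    \<open>b\<close> for \<open>x'\<close> in the second and \<open>b\<close> for \<open>y'\<close>
    in the third.\<close>
  have inner: "(\<Sum>(x', y')\<in>?P. \<omega> a x * \<omega> (\<gamma> b) (commutator mult y x') * \<omega> c y'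
        - \<omega> (\<gamma> a) (x \<bullet> x') * \<omega> b y' * \<omega> c y + \<omega> a x * \<omega> b x' * \<omega> (\<gamma> c) (y \<bullet> y'))
      = \<omega> a x * \<omega> (\<gamma> b) (commutator mult y c) - \<omega> c y * \<omega> (\<gamma> a) (x \<bullet> b) + \<omega> a x * \<omega> (\<gamma> c) (y \<bullet> b)"
    if xy: "(x, y) \<in> ?P" for x y
  proof -
    have B: "x \<in> B" "y \<in> B"
      using xy keys_r_B by auto
    have "(\<Sum>(x', y')\<in>?P. \<omega> a x * \<omega> (\<gamma> b) (commutator mult y x') * \<omega> c y'
        - \<omega> (\<gamma> a) (x \<bullet> x') * \<omega> b y' * \<omega> c y + \<omega> a x * \<omega> b x' * \<omega> (\<gamma> c) (y \<bullet> y'))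
      = \<omega> a x * (\<Sum>(x', y')\<in>?P. \<omega> c y' * \<omega> (\<gamma> b) (commutator mult y x'))
        - \<omega> c y * (\<Sum>(x', y')\<in>?P. \<omega> b y' * \<omega> (\<gamma> a) (x \<bullet> x'))
        + \<omega> a x * (\<Sum>(x', y')\<in>?P. \<omega> b x' * \<omega> (\<gamma> c) (y \<bullet> y'))"
      by (simp add: split_beta sum.distrib sum_subtractf sum_distrib_left mult_ac)
    then show ?thesis
      by (simp add: r_contract r_contract' a linC linL linR \<gamma>B B)
  qed
  have "free_eval (\<lambda>(x, y, z). \<omega> (\<gamma> a) x * \<omega> (\<gamma> b) y * \<omega> (\<gamma> c) z) (tensor_bracket mult \<gamma> r)
    = (\<Sum>(x, y)\<in>?P. \<Sum>(x', y')\<in>?P. \<omega> a x * \<omega> (\<gamma> b) (commutator mult y x') * \<omega> c y'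
        - \<omega> (\<gamma> a) (x \<bullet> x') * \<omega> b y' * \<omega> c y + \<omega> a x * \<omega> b x' * \<omega> (\<gamma> c) (y \<bullet> y'))"
    unfolding tensor_bracket_def
    by (simp add: free_eval_sum split_beta free_eval_scale free_eval_add free_eval_diff
        free_eval_tensor3 \<omega>_twist lookup_r)
  also have "\<dots> = (\<Sum>(x, y)\<in>?P. \<omega> a x * \<omega> (\<gamma> b) (commutator mult y c)
      - \<omega> c y * \<omega> (\<gamma> a) (x \<bullet> b) + \<omega> a x * \<omega> (\<gamma> c) (y \<bullet> b))"
    by (rule sum.cong) (auto simp: inner)
  also have "\<dots> = (\<Sum>(x, y)\<in>?P. \<omega> a x * \<omega> (\<gamma> b) (commutator mult y c))
      - (\<Sum>(x, y)\<in>?P. \<omega> c y * \<omega> (\<gamma> a) (x \<bullet> b)) + (\<Sum>(x, y)\<in>?P. \<omega> a x * \<omega> (\<gamma> c) (y \<bullet> b))"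
    by (simp add: split_beta sum.distrib sum_subtractf)
  also have "\<dots> = \<omega> (\<gamma> b) (commutator mult a c) - \<omega> (\<gamma> a) (c \<bullet> b) + \<omega> (\<gamma> c) (a \<bullet> b)"
    by (simp add: r_contract r_contract' a linC linL linR \<gamma>B)
  also have "\<dots> = 0"
    by (rule \<omega>_bracket[OF a])
  finally show ?thesis .
qed

text \<open>\<gamma> maps \<open>B\<close> onto itself, so every test vector is a
  \<gamma>-image.\<close>

lemma bracket_eval_\<omega>:
  assumes "a \<in> B" "b \<in> B" "c \<in> B"
  shows "free_eval (\<lambda>(x, y, z). \<omega> a x * \<omega> b y * \<omega> c z) (tensor_bracket mult \<gamma> r) = 0"
proof -
  have surj: "\<exists>d'\<in>B. d = \<gamma> d'" if "d \<in> B" for d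
    using that bij_betw_imp_surj_on[OF twist_bij_B] by blast
  obtain a' b' c' where "a' \<in> B" "a = \<gamma> a'" "b' \<in> B" "b = \<gamma> b'" "c' \<in> B" "c = \<gamma> c'"
    using surj[OF assms(1)] surj[OF assms(2)] surj[OF assms(3)] by blast
  then show ?thesis
    using bracket_eval by simp
qed

text \<open>Tensors supported in a fixed set form a subspace, so it suffices to look at the
  \<open>tensor3\<close> terms, whose legs lie in \<open>B\<close> by closure.\<close>

lemma keys_bracket: "Poly_Mapping.keys (tensor_bracket mult \<gamma> r) \<subseteq> B \<times> B \<times> B"
proof -
  interpret L: hom_pre_Lie_algebra S B mult \<gamma>
    by (rule double_hom_pre_Lie)
  have closed: "free.subspace {t :: _ \<Rightarrow>\<^sub>0 'k. Poly_Mapping.keys t \<subseteq> K}" for K :: "'z set"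
    by (auto simp: free.subspace_def in_keys_iff subset_iff lookup_add) (metis add_0)
  have t3: "tensor3 x y z \<in> {t :: _ \<Rightarrow>\<^sub>0 'k. Poly_Mapping.keys t \<subseteq> B \<times> B \<times> B}"
    if "x \<in> B" "y \<in> B" "z \<in> B" for x y z
    using that by (auto simp: tensor3_def)
  have comm: "commutator mult x y \<in> B" if "x \<in> B" "y \<in> B" for x y
    using that unfolding commutator_def by (intro D.subspace_diff[OF subspace_B] L.mult_closed)
  have keys: "fst k \<in> B" "snd k \<in> B" if "k \<in> Poly_Mapping.keys r" for k
    using that keys_r_B by auto
  have "tensor_bracket mult \<gamma> r \<in> {t. Poly_Mapping.keys t \<subseteq> B \<times> B \<times> B}"
    unfolding tensor_bracket_def split_beta
    by (intro free.subspace_sum[OF closed] free.subspace_scale[OF closed]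
        free.subspace_add[OF closed] free.subspace_diff[OF closed] t3 L.twist_closed L.mult_closed
        comm keys)
  then show ?thesis by simp
qed

lemma bracket_null: "tensor_bracket mult \<gamma> r \<in> tensor3_null S B"
proof -
  let ?W1 = "(\<lambda>v. (v, 0)) ` V" and ?W2 = "(\<lambda>v. (0, dvec v)) ` V"
  have dvec_V: "dvec v w = (if v = w then 1 else 0)" if "v \<in> V" "w \<in> V" for v w
    using that representation_basis[OF fin.independent_Basis] by (auto simp: dual_vec_def)
  have inj: "inj_on dvec V"
    by (rule inj_onI) (metis dvec_V zero_neq_one)
  have disj: "?W1 \<inter> ?W2 = {}"
    using zero_notin_V by auto
  \<comment> \<open>The partner of a basis vector under \<omega>: \<open>(v, 0)\<close> and
    \<open>(0, dvec v)\<close> are exchanged. Testing \<open>snd p = 0\<close> tells the families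
    apart because \<open>dvec v\<close> is nonzero for \<open>v\<close> in \<open>V\<close>, and
    injectivity of \<open>dvec\<close> on \<open>V\<close> recovers \<open>v\<close>.\<close>
  define dual_of where "dual_of p = (if snd p = 0 then (0, dvec (fst p)) else (inv_into V dvec (snd p), 0))"
    for p :: "'a \<times> ('a \<Rightarrow> 'k)"
  have dvec_nz: "dvec v \<noteq> 0" if "v \<in> V" for v
    using dvec_V[OF that that] by auto
  have "x = (\<Sum>w\<in>?W1 \<union> ?W2. S (\<omega> (dual_of w) x) w)" if "x \<in> B" for x
  proof -
    have "(\<Sum>w\<in>?W1 \<union> ?W2. S (\<omega> (dual_of w) x) w)
      = (\<Sum>w\<in>?W1. S (\<omega> (dual_of w) x) w) + (\<Sum>w\<in>?W2. S (\<omega> (dual_of w) x) w)"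
      using disj fin.finite_Basis by (intro sum.union_disjoint) auto
    also have "(\<Sum>w\<in>?W1. S (\<omega> (dual_of w) x) w) = (\<Sum>v\<in>V. S (\<omega> (0, dvec v) x) (v, 0))"
      by (subst sum.reindex) (auto simp: inj_on_def dual_of_def)
    also have "(\<Sum>w\<in>?W2. S (\<omega> (dual_of w) x) w) = (\<Sum>v\<in>V. S (\<omega> (v, 0) x) (0, dvec v))"
      using inj by (subst sum.reindex)
        (auto simp: inj_on_def dual_of_def dvec_nz intro!: sum.cong)
    finally show ?thesis
      using B_expansion[OF that] by (simp only: sum.distrib)
  qed
  moreover have "dual_of w \<in> B" if "w \<in> ?W1 \<union> ?W2" for w
    using that by (auto simp: dual_of_def dvec_dual zero_dual)
  moreover have "finite (?W1 \<union> ?W2)" "?W1 \<union> ?W2 \<subseteq> B"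
    using fin.finite_Basis by (auto simp: dvec_dual zero_dual)
  ultimately show ?thesis
    \<comment> \<open>The coordinate functionals are themselves of the form
      \<open>\<omega> a\<close>, so the evaluations to be checked are those of
      \<open>bracket_eval_\<omega>\<close>.\<close>
    by (intro tensor3_nullI[OF vector_space_S subspace_B, where c = "\<lambda>w. \<omega> (dual_of w)" and W = "?W1 \<union> ?W2"]
        keys_bracket bracket_eval_\<omega>) auto
qed

lemma hom_s_matrix_r: "hom_s_matrix S B mult \<gamma> r"
  unfolding hom_s_matrix_def
  using double_hom_pre_Lie twist_bij_B keys_r_B sharp_twist bracket_null
  by (simp add: flip_r tensor2_null_def free.span_zero)

end

theorem corollary5p15:
  fixes scale :: "'k::field \<Rightarrow> 'a::ab_group_add \<Rightarrow> 'a"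
    and rtri ltri :: "'a \<Rightarrow> 'a \<Rightarrow> 'a"
    and \<alpha> :: "'a \<Rightarrow> 'a"
    and V :: "'a set"
  assumes "hom_L_dendriform_algebra scale rtri ltri \<alpha>"
    and "bij \<alpha>"
    and "finite_dimensional_vector_space scale V"
  shows "hom_s_matrix (double_scale scale) (double_space scale)
    (double_mult rtri ltri \<alpha>) (double_twist \<alpha>)
    (\<Sum>v\<in>V. tensor2 (v, 0) (0, dual_vec scale V v) + tensor2 (0, dual_vec scale V v) (v, 0))"
proof -
  interpret hom_L_dendriform_algebra scale rtri ltri \<alpha> by fact
  interpret fin: finite_dimensional_vector_space scale V by fact
  interpret regular_hom_L_dendriform_algebra scale rtri ltri \<alpha> V
    by unfold_locales fact
  show ?thesis
    using hom_s_matrix_r unfolding r_def .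
qed

end
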